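(* Let $n\ge 1$ and let $\mathcal{T}$ be a locally finite polytopal tiling of $\mathbb{R}^n$. Then there is no point $x\in\mathbb{R}^n$ such that $x$ is a vertex of exactly one polytope of $\mathcal{T}$.
   Context: A polytope is a bounded intersection of finitely many closed halfspaces (so polytopes are convex); tiles are polytopes with nonempty interior in $\mathbb{R}^n$. A polytopal tiling of $\mathbb{R}^n$ is a countable collection $\mathcal{T}$ of such polytopes whose union is $\mathbb{R}^n$ and whose interiors are pairwise disjoint. It is locally finite if each bounded subset of $\mathbb{R}^n$ intersects only finitely many tiles of $\mathcal{T}$. "Vertex" means a vertex of a convex polytope in the usual geometric sense (an extreme point, i.e. a $0$-dimensional face); tilings are not assumed to be vertex-to-vertex or face-to-face. *)

theory Defs
  imports "HOL-Analysis.Analysis"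
begin

(* A bounded polyhedron is the same as a library polytope (convex hull of a finite set),
   see polytope_eq_bounded_polyhedron; here polytopes are introduced via halfspaces. *)
definition polytopal_tile :: "'a::euclidean_space set \<Rightarrow> bool" where
  "polytopal_tile P \<longleftrightarrow> polyhedron P \<and> bounded P \<and> interior P \<noteq> {}"

(* A set of tiles loses nothing against an indexed family: tiles with nonempty and
   pairwise disjoint interiors cannot repeat. *)
definition polytopal_tiling :: "'a::euclidean_space set set \<Rightarrow> bool" where
  "polytopal_tiling \<T> \<longleftrightarrow>
     countable \<T> \<and>
     (\<forall>P\<in>\<T>. polytopal_tile P) \<and>
     \<Union>\<T> = UNIV \<and>
     pairwise (\<lambda>P Q. interior P \<inter> interior Q = {}) \<T>"

definition locally_finite_tiles :: "'a::euclidean_space set set \<Rightarrow> bool" where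
  "locally_finite_tiles \<T> \<longleftrightarrow>
     (\<forall>B. bounded B \<longrightarrow> finite {P \<in> \<T>. P \<inter> B \<noteq> {}})"

end

theory Submission
  imports Defs
begin

text \<open>
  Let \<open>x\<close> be a vertex of exactly one tile \<open>P\<close>. The tangent cones at \<open>x\<close> of the tiles containing \<open>x\<close>
  cover the space and overlap in null sets, so their indicator functions add up to 1 almost
  everywhere. The cone of a tile \<open>Q \<noteq> P\<close> contains a line, hence its indicator is invariant
  under some translation \<open>l\<^sub>Q \<noteq> 0\<close> and is killed by the difference operator
  \<open>f \<mapsto> (\<lambda>v. f v - f (v - l\<^sub>Q))\<close>. Applying all these operators leaves an iterated difference of
  the indicator of the cone of \<open>P\<close> that vanishes almost everywhere. This cone is pointed, and on
  functions supported in translates of a pointed cone each difference operator is injective up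
  to null sets. So the cone of \<open>P\<close> would be a null set, although it contains a translate of \<open>P\<close>.
\<close>

section \<open>Difference operators modulo null sets\<close>

lemma AE_lebesgue_iff_negligible:
  "(AE v in lebesgue. P v) \<longleftrightarrow> negligible {v. \<not> P v}"
  by (simp add: negligible_iff_null_sets completion.AE_iff_null_sets)

lemma AE_lebesgue_translation:
  fixes a :: "'a::euclidean_space"
  assumes "AE v in lebesgue. P v"
  shows "AE v in lebesgue. P (v + a)"
proof -
  have "negligible ((+) (- a) ` {v. \<not> P v})"
    using assms by (intro negligible_translation) (simp add: AE_lebesgue_iff_negligible)
  moreover have "{v. \<not> P (v + a)} \<subseteq> (+) (- a) ` {v. \<not> P v}"
  proof
    fix v assume "v \<in> {v. \<not> P (v + a)}"
    then show "v \<in> (+) (- a) ` {v. \<not> P v}"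
      by (intro image_eqI[of _ _ "v + a"]) auto
  qed
  ultimately show ?thesis
    unfolding AE_lebesgue_iff_negligible by (rule negligible_subset)
qed

text \<open>The region \<open>norm v \<le> u \<bullet> v + d\<close> contains no line. A nonzero
  value at a generic \<open>v\<close> would recur at \<open>v + k l\<close> and
  \<open>v - k l\<close> for every \<open>k\<close>, hence arbitrarily far out along a line in both
  directions.\<close>

lemma AE_periodic_imp_zero:
  fixes f :: "'a::euclidean_space \<Rightarrow> real"
  assumes per: "AE v in lebesgue. f v = f (v - l)" and "l \<noteq> 0"
    and supp: "\<And>v. f v \<noteq> 0 \<Longrightarrow> norm v \<le> u \<bullet> v + d"
  shows "AE v in lebesgue. f v = 0"
proof -
  have minus: "AE v in lebesgue. f v = f (v - real k *\<^sub>R l)" for k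
  proof (induction k)
    case (Suc k)
    have "AE v in lebesgue. f (v - real k *\<^sub>R l) = f (v - real k *\<^sub>R l - l)"
      using AE_lebesgue_translation[OF per, of "- real k *\<^sub>R l"] by simp
    with Suc.IH show ?case
      by eventually_elim (simp add: algebra_simps)
  qed simp
  have plus: "AE v in lebesgue. f (v + real k *\<^sub>R l) = f v" for k
    using AE_lebesgue_translation[OF minus[of k], of "real k *\<^sub>R l"] by simp
  \<comment> \<open>Only countably many \<open>k\<close> occur, so one null set serves all of
    them.\<close>
  have "AE v in lebesgue. \<forall>k. f v = f (v - real k *\<^sub>R l) \<and> f (v + real k *\<^sub>R l) = f v"
    using minus plus by (simp add: AE_all_countable)
  then show ?thesis
  proof eventually_elim
    case (elim v)
    show "f v = 0"
    proof (rule ccontr)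
      assume "f v \<noteq> 0"
      then have nz: "f (v - real k *\<^sub>R l) \<noteq> 0" "f (v + real k *\<^sub>R l) \<noteq> 0" for k
        using elim by metis+
      have "real k * norm l \<le> u \<bullet> v + d" for k
      proof -
        have "norm ((v + real k *\<^sub>R l) - (v - real k *\<^sub>R l))
            \<le> norm (v + real k *\<^sub>R l) + norm (v - real k *\<^sub>R l)"
          by (rule norm_triangle_ineq4)
        \<comment> \<open>The contributions of \<open>u \<bullet> l\<close> from the two opposite
          translates cancel, which makes the bound independent of \<open>k\<close>.\<close>
        also have "\<dots> \<le> 2 * (u \<bullet> v + d)"
          using supp[OF nz(1)[of k]] supp[OF nz(2)[of k]] by (simp add: inner_simps)
        also have "(v + real k *\<^sub>R l) - (v - real k *\<^sub>R l) = (2 * real k) *\<^sub>R l"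
          by (simp add: algebra_simps flip: scaleR_2)
        finally show ?thesis by simp
      qed
      moreover obtain k where "u \<bullet> v + d < real k * norm l"
        using \<open>l \<noteq> 0\<close> ex_less_of_nat_mult[of "norm l" "u \<bullet> v + d"] by auto
      ultimately show False
        by (metis not_less)
    qed
  qed
qed

text \<open>Induction on \<open>I\<close>: differencing along \<open>l j\<close> kills
  \<open>g j\<close> and preserves the period of every other \<open>g i\<close>. The induction
  hypothesis then makes the difference of \<open>f\<close> vanish almost everywhere, so
  \<open>f\<close> has period \<open>l j\<close> up to a null set and the periodic case
  applies.\<close>

lemma AE_zero_if_sum_invariant:
  fixes f :: "'a::euclidean_space \<Rightarrow> real" and g :: "'i \<Rightarrow> 'a \<Rightarrow> real"
  assumes "finite I"
    and "\<And>i. i \<in> I \<Longrightarrow> l i \<noteq> 0"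
    and "\<And>i v. i \<in> I \<Longrightarrow> g i (v - l i) = g i v"
    and "\<And>v. f v \<noteq> 0 \<Longrightarrow> norm v \<le> u \<bullet> v + d"
    and "AE v in lebesgue. f v + (\<Sum>i\<in>I. g i v) = 0"
  shows "AE v in lebesgue. f v = 0"
  using assms
proof (induction I arbitrary: f g d rule: finite_induct)
  case (insert j I)
  define f' where "f' v = f v - f (v - l j)" for v
  define g' where "g' i v = g i v - g i (v - l j)" for i v
  have sum0: "AE v in lebesgue. f v + g j v + (\<Sum>i\<in>I. g i v) = 0"
    using insert.prems(4) insert.hyps by (simp add: add.assoc)
  have "AE v in lebesgue. f (v - l j) + g j (v - l j) + (\<Sum>i\<in>I. g i (v - l j)) = 0"
    using AE_lebesgue_translation[OF sum0, of "- l j"] by simp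
  with sum0 have "AE v in lebesgue. f' v + (\<Sum>i\<in>I. g' i v) = 0"
  proof eventually_elim
    case (elim v)
    then show ?case
      using insert.prems(2)[of j v] by (simp add: f'_def g'_def sum_subtractf)
  qed
  \<comment> \<open>Translating the support by \<open>l j\<close> costs only a larger offset, so the
    induction generalises over \<open>d\<close> while \<open>u\<close> stays fixed.\<close>
  moreover have "norm v \<le> u \<bullet> v + (d + norm (l j) + \<bar>u \<bullet> l j\<bar>)" if "f' v \<noteq> 0" for v
  proof -
    from that consider "f v \<noteq> 0" | "f (v - l j) \<noteq> 0"
      by (fastforce simp: f'_def)
    then show ?thesis
    proof cases
      case 1
      then show ?thesis
        using insert.prems(3)[of v] norm_ge_zero[of "l j"] by linarith
    next
      case 2
      with insert.prems(3) have "norm (v - l j) \<le> u \<bullet> (v - l j) + d" .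
      then show ?thesis
        using norm_triangle_sub[of v "l j"] by (simp add: inner_simps)
    qed
  qed
  moreover have "g' i (v - l i) = g' i v" if "i \<in> I" for i v
    using insert.prems(2)[of i v] insert.prems(2)[of i "v - l j"] that
    by (simp add: g'_def algebra_simps)
  ultimately have "AE v in lebesgue. f' v = 0"
    using insert.prems(1) by (intro insert.IH[of g' f']) auto
  then have "AE v in lebesgue. f v = f (v - l j)"
    by (simp add: f'_def)
  then show ?case
    by (rule AE_periodic_imp_zero) (use insert.prems in auto)
qed simp

section \<open>Tangent cones of convex sets and polytopes\<close>

text \<open>This is the cone of feasible directions, with no closure taken; for a polyhedron
  containing \<open>x\<close> it agrees with the usual tangent cone.\<close>

definition tangent_cone :: "'a::real_vector set \<Rightarrow> 'a \<Rightarrow> 'a set" where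
  "tangent_cone P x = {v. \<exists>t>0. x + t *\<^sub>R v \<in> P}"

lemma tangent_cone_small:
  assumes "convex P" "x \<in> P" "x + t *\<^sub>R v \<in> P" "0 \<le> s" "s \<le> t"
  shows "x + s *\<^sub>R v \<in> P"
proof (cases "t = 0")
  case False
  with assms have "(1 - s / t) *\<^sub>R x + (s / t) *\<^sub>R (x + t *\<^sub>R v) \<in> P"
    by (intro convexD) (auto simp: divide_simps)
  then show ?thesis
    using False by (simp add: algebra_simps)
qed (use assms in auto)

text \<open>By convexity both directions admit a common step \<open>r\<close>; the midpoint of the
  two resulting points then realises \<open>v + w\<close> with step \<open>r/2\<close>.\<close>

lemma tangent_cone_add:
  assumes "convex P" "x \<in> P" "v \<in> tangent_cone P x" "w \<in> tangent_cone P x"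
  shows "v + w \<in> tangent_cone P x"
proof -
  obtain s t where st: "s > 0" "x + s *\<^sub>R v \<in> P" "t > 0" "x + t *\<^sub>R w \<in> P"
    using assms by (auto simp: tangent_cone_def)
  define r where "r = min s t"
  have r: "r > 0" "x + r *\<^sub>R v \<in> P" "x + r *\<^sub>R w \<in> P"
    using st assms tangent_cone_small[of P x _ _ r] by (auto simp: r_def)
  have "(1/2) *\<^sub>R (x + r *\<^sub>R v) + (1/2) *\<^sub>R (x + r *\<^sub>R w) \<in> P"
    using r assms by (intro convexD) auto
  also have "(1/2) *\<^sub>R (x + r *\<^sub>R v) + (1/2) *\<^sub>R (x + r *\<^sub>R w) =
      ((1/2) *\<^sub>R x + (1/2) *\<^sub>R x) + (r/2) *\<^sub>R (v + w)"
    by (simp only: scaleR_add_right scaleR_scaleR) simp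
  also have "(1/2) *\<^sub>R x + (1/2) *\<^sub>R x = x"
    by (simp flip: scaleR_add_left)
  finally show ?thesis
    using r unfolding tangent_cone_def by (auto intro!: exI[of _ "r/2"])
qed

text \<open>A point of \<open>P\<close> that is not a vertex lies inside a segment of
  \<open>P\<close>, so the cone contains both directions \<open>l\<close> and \<open>- l\<close> of
  that segment. Closure under addition turns this into invariance under translation by
  \<open>l\<close>.\<close>

lemma tangent_cone_invariant:
  assumes "convex P" "x \<in> P" "\<not> x extreme_point_of P"
  shows "\<exists>l. l \<noteq> 0 \<and> (\<forall>v. v - l \<in> tangent_cone P x \<longleftrightarrow> v \<in> tangent_cone P x)"
proof -
  obtain a b where ab: "a \<in> P" "b \<in> P" "x \<in> open_segment a b"
    using assms by (auto simp: extreme_point_of_def)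
  then obtain t where t: "a \<noteq> b" "0 < t" "t < 1" "x = (1 - t) *\<^sub>R a + t *\<^sub>R b"
    by (auto simp: in_segment)
  define l where "l = b - a"
  have "x + (1 - t) *\<^sub>R l = b" "x + t *\<^sub>R (- l) = a"
    using t by (simp_all add: l_def algebra_simps)
  then have l: "l \<in> tangent_cone P x" "- l \<in> tangent_cone P x"
    using ab t by (auto simp: tangent_cone_def intro: exI[of _ "1 - t"] exI[of _ t])
  have "v - l \<in> tangent_cone P x \<longleftrightarrow> v \<in> tangent_cone P x" for v
    using tangent_cone_add[OF assms(1,2) _ l(1), of "v - l"]
      tangent_cone_add[OF assms(1,2) _ l(2), of v] by auto
  moreover have "l \<noteq> 0"
    using t by (simp add: l_def)
  ultimately show ?thesis by blast
qed

text \<open>The convex set \<open>P \<inter> Q\<close> has empty interior, so it lies in its own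
  frontier and is null. The common directions are covered by countably many dilates of its translate
  by \<open>- x\<close>.\<close>

lemma negligible_tangent_cone_Int:
  fixes P Q :: "'a::euclidean_space set"
  assumes "convex P" "convex Q" "x \<in> P" "x \<in> Q" "interior P \<inter> interior Q = {}"
  shows "negligible (tangent_cone P x \<inter> tangent_cone Q x)"
proof -
  have "P \<inter> Q \<subseteq> frontier (P \<inter> Q)"
    using assms closure_subset[of "P \<inter> Q"] by (auto simp: frontier_def)
  then have null: "negligible (P \<inter> Q)"
    using negligible_convex_frontier[of "P \<inter> Q"] assms
    by (meson convex_Int negligible_subset)
  have "tangent_cone P x \<inter> tangent_cone Q x
      \<subseteq> (\<Union>k::nat. (*\<^sub>R) (real (Suc k)) ` (+) (- x) ` (P \<inter> Q))"
  proof
    fix v assume "v \<in> tangent_cone P x \<inter> tangent_cone Q x"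
    then obtain s t where st: "s > 0" "x + s *\<^sub>R v \<in> P" "t > 0" "x + t *\<^sub>R v \<in> Q"
      by (auto simp: tangent_cone_def)
    \<comment> \<open>Steps of the form \<open>1 / (k + 1)\<close> suffice by convexity, which keeps
      the union countable.\<close>
    then obtain k where k: "inverse (real (Suc k)) < min s t"
      using reals_Archimedean[of "min s t"] by auto
    define y where "y = x + inverse (real (Suc k)) *\<^sub>R v"
    have "y \<in> P \<inter> Q"
      unfolding y_def
      using st k assms tangent_cone_small[of P x s v] tangent_cone_small[of Q x t v]
      by (simp add: less_imp_le del: of_nat_Suc)
    moreover have "v = real (Suc k) *\<^sub>R (- x + y)"
      by (simp add: y_def del: of_nat_Suc)
    ultimately show "v \<in> (\<Union>k::nat. (*\<^sub>R) (real (Suc k)) ` (+) (- x) ` (P \<inter> Q))"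
      by blast
  qed
  moreover have "negligible (\<Union>k::nat. (*\<^sub>R) (real (Suc k)) ` (+) (- x) ` (P \<inter> Q))"
    by (intro negligible_Union_nat negligible_differentiable_image_negligible[OF order_refl]
        negligible_translation null) (auto intro!: derivative_intros)
  ultimately show ?thesis
    by (rule negligible_subset[rotated])
qed

text \<open>A hyperplane strictly separates the vertex from the other generators. A large enough
  multiple of its normal dominates the norm on the generators seen from \<open>x\<close>; convexity
  carries the bound to \<open>P\<close>, and homogeneity to the cone.\<close>

lemma tangent_cone_pointed:
  fixes P :: "'a::euclidean_space set"
  assumes "polytope P" "x extreme_point_of P"
  shows "\<exists>u. \<forall>v\<in>tangent_cone P x. norm v \<le> u \<bullet> v"
proof -
  obtain V where V: "finite V" "P = convex hull V"
    using assms by (auto simp: polytope_def)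
  define W where "W = (\<lambda>w. w - x) ` (V - {x})"
  \<comment> \<open>Extremality enters here: the hull of the remaining generators stays inside this
    convex set and so misses \<open>x\<close>.\<close>
  have "convex (P - {x})"
    using assms extreme_point_of_stillconvex polytope_imp_convex by blast
  moreover have "V - {x} \<subseteq> P - {x}"
    using V hull_subset[of V convex] by blast
  ultimately have "x \<notin> convex hull (V - {x})"
    using hull_minimal[of "V - {x}" "P - {x}" convex] by blast
  moreover have "closed (convex hull (V - {x}))"
    using V by (simp add: compact_imp_closed finite_imp_compact_convex_hull)
  ultimately obtain a b where ab: "a \<bullet> x < b" "\<forall>w\<in>convex hull (V - {x}). b < a \<bullet> w"
    using separating_hyperplane_closed_point[of "convex hull (V - {x})" x] by auto
  then have pos: "a \<bullet> w \<ge> b - a \<bullet> x" if "w \<in> W" for w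
    using that hull_inc[of _ "V - {x}" convex]
    by (fastforce simp: W_def inner_simps)
  obtain M where M: "M > 0" "\<And>w. w \<in> W \<Longrightarrow> norm w \<le> M"
    using V finite_imp_bounded[of W] by (auto simp: W_def bounded_pos)
  \<comment> \<open>On \<open>W\<close> the functional \<open>a\<close> is at least the gap
    \<open>b - a \<bullet> x\<close>, so this scaling lifts it to at least \<open>M\<close>, a bound
    for the norms.\<close>
  define u where "u = (M / (b - a \<bullet> x)) *\<^sub>R a"
  have W: "norm w \<le> u \<bullet> w" if "w \<in> W" for w
  proof -
    have "M = M / (b - a \<bullet> x) * (b - a \<bullet> x)"
      using ab by simp
    also have "\<dots> \<le> M / (b - a \<bullet> x) * (a \<bullet> w)"
      using ab M pos[OF that] by (intro mult_left_mono) auto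
    finally show ?thesis
      using M(2)[OF that] by (simp add: u_def)
  qed
  \<comment> \<open>A sublevel set of a convex function (norm minus a linear term), so it contains
    \<open>P\<close> once it contains \<open>V\<close>.\<close>
  have "convex {y. norm (y - x) - u \<bullet> (y - x) \<le> 0}"
  proof (rule convexI, clarsimp)
    fix y z :: 'a and s t :: real
    assume yz: "norm (y - x) \<le> u \<bullet> (y - x)" "norm (z - x) \<le> u \<bullet> (z - x)"
      and st: "0 \<le> s" "0 \<le> t" "s + t = 1"
    have eq: "s *\<^sub>R y + t *\<^sub>R z - x = s *\<^sub>R (y - x) + t *\<^sub>R (z - x)"
      using st by (simp add: algebra_simps flip: scaleR_add_left)
    have "norm (s *\<^sub>R (y - x) + t *\<^sub>R (z - x)) \<le> s * norm (y - x) + t * norm (z - x)"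
      using st norm_triangle_ineq[of "s *\<^sub>R (y - x)" "t *\<^sub>R (z - x)"] by simp
    also have "\<dots> \<le> s * (u \<bullet> (y - x)) + t * (u \<bullet> (z - x))"
      using st yz by (intro add_mono mult_left_mono)
    finally show "norm (s *\<^sub>R y + t *\<^sub>R z - x) \<le> u \<bullet> (s *\<^sub>R y + t *\<^sub>R z - x)"
      unfolding eq by (simp only: inner_add_right inner_scaleR_right)
  qed
  moreover have "V \<subseteq> {y. norm (y - x) - u \<bullet> (y - x) \<le> 0}"
    using W by (force simp: W_def)
  ultimately have "P \<subseteq> {y. norm (y - x) - u \<bullet> (y - x) \<le> 0}"
    unfolding V(2) by (intro hull_minimal)
  then have P: "norm (y - x) \<le> u \<bullet> (y - x)" if "y \<in> P" for y
    using that by auto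
  have "norm v \<le> u \<bullet> v" if v: "v \<in> tangent_cone P x" for v
  proof -
    obtain t where "t > 0" "x + t *\<^sub>R v \<in> P"
      using v by (auto simp: tangent_cone_def)
    with P[of "x + t *\<^sub>R v"] show ?thesis by simp
  qed
  then show ?thesis by blast
qed

text \<open>Near \<open>x\<close> only finitely many tiles avoid \<open>x\<close>; being closed,
  they leave a ball around \<open>x\<close> free. A short step along \<open>v\<close> stays in that
  ball and hence lands in a tile containing \<open>x\<close>.\<close>

lemma tangent_cones_cover:
  fixes \<T> :: "'a::euclidean_space set set"
  assumes "locally_finite_tiles \<T>" "\<Union>\<T> = UNIV" "\<And>P. P \<in> \<T> \<Longrightarrow> closed P"
  shows "\<exists>P\<in>\<T>. x \<in> P \<and> v \<in> tangent_cone P x"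
proof -
  define F where "F = {P \<in> \<T>. P \<inter> cball x (norm v) \<noteq> {} \<and> x \<notin> P}"
  have "finite {P \<in> \<T>. P \<inter> cball x (norm v) \<noteq> {}}"
    using assms by (simp add: locally_finite_tiles_def)
  then have "finite F"
    by (rule rev_finite_subset) (auto simp: F_def)
  then have "closed (\<Union>F)"
    using assms by (intro closed_Union) (auto simp: F_def)
  moreover have "x \<notin> \<Union>F"
    by (auto simp: F_def)
  ultimately obtain e where e: "e > 0" "ball x e \<inter> \<Union>F = {}"
    by (metis ComplI disjoint_eq_subset_Compl openE open_Compl)
  \<comment> \<open>The bound 1 keeps the point in \<open>cball x (norm v)\<close>, where
    \<open>F\<close> was collected; the added 1 in the denominator covers \<open>v = 0\<close> and
    makes \<open>t * norm v < e\<close> strict.\<close>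
  define t where "t = min 1 (e / (norm v + 1))"
  have np: "norm v + 1 > 0"
    by (smt (verit) norm_ge_zero)
  have t: "t > 0" "t \<le> 1"
    using e np by (auto simp: t_def)
  have "t * norm v \<le> e / (norm v + 1) * norm v"
    by (intro mult_right_mono) (auto simp: t_def)
  also have "\<dots> < e"
    using e np by (simp add: field_simps)
  finally have "x + t *\<^sub>R v \<in> ball x e"
    using t by (simp add: dist_norm)
  moreover have "x + t *\<^sub>R v \<in> cball x (norm v)"
    using t by (simp add: dist_norm mult_left_le_one_le)
  moreover obtain P where "P \<in> \<T>" "x + t *\<^sub>R v \<in> P"
    using assms(2) by blast
  ultimately have "x \<in> P"
    using e(2) by (fastforce simp only: F_def)
  then show ?thesis
    using \<open>P \<in> \<T>\<close> \<open>x + t *\<^sub>R v \<in> P\<close> t by (auto simp: tangent_cone_def)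
qed

section \<open>The cones at a vertex of a single tile\<close>

theorem theorem2p5:
  fixes \<T> :: "(real ^ 'n) set set"
  assumes "polytopal_tiling \<T>"
    and "locally_finite_tiles \<T>"
  shows "\<not> (\<exists>x. \<exists>!P. P \<in> \<T> \<and> x extreme_point_of P)"
proof
  assume "\<exists>x. \<exists>!P. P \<in> \<T> \<and> x extreme_point_of P"
  then obtain x P where P: "P \<in> \<T>" "x extreme_point_of P"
    and uniq: "\<And>Q. Q \<in> \<T> \<Longrightarrow> x extreme_point_of Q \<Longrightarrow> Q = P"
    by blast
  have tile: "polytope Q" "interior Q \<noteq> {}" if "Q \<in> \<T>" for Q
    using assms(1) that
    by (auto simp: polytopal_tiling_def polytopal_tile_def polytope_eq_bounded_polyhedron)
  have disj: "interior Q \<inter> interior R = {}" if "Q \<in> \<T>" "R \<in> \<T>" "Q \<noteq> R" for Q R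
    using assms(1) that by (auto simp: polytopal_tiling_def pairwise_def)
  define I where "I = {Q \<in> \<T>. x \<in> Q}"
  define C where "C Q = tangent_cone Q x" for Q
  have "{Q \<in> \<T>. Q \<inter> {x} \<noteq> {}} = I"
    by (auto simp: I_def)
  then have fin: "finite I"
    using assms(2)[unfolded locally_finite_tiles_def, rule_format, of "{x}"] by simp
  have PI: "P \<in> I"
    using P by (auto simp: I_def extreme_point_of_def)
  have cover: "\<exists>Q\<in>I. v \<in> C Q" for v
    using tangent_cones_cover[OF assms(2), of x v] assms(1) tile
    by (auto simp: I_def C_def polytopal_tiling_def polytope_imp_closed)
  have "negligible (C Q \<inter> C R)" if "Q \<in> I" "R \<in> I" "Q \<noteq> R" for Q R
    unfolding C_def using that tile disj
    by (intro negligible_tangent_cone_Int) (auto simp: I_def polytope_imp_convex)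
  then have "AE v in lebesgue. Q \<noteq> R \<longrightarrow> \<not> (v \<in> C Q \<and> v \<in> C R)" if "Q \<in> I" "R \<in> I" for Q R
    using that by (cases "Q = R") (auto simp: AE_lebesgue_iff_negligible Int_def)
  then have "AE v in lebesgue. \<forall>Q\<in>I. \<forall>R\<in>I. Q \<noteq> R \<longrightarrow> \<not> (v \<in> C Q \<and> v \<in> C R)"
    using fin by (intro AE_finite_allI)
  \<comment> \<open>Covering gives at least one cone through \<open>v\<close>; off the null overlaps
    there is at most one.\<close>
  then have sum1: "AE v in lebesgue. (\<Sum>Q\<in>I. indicat_real (C Q) v) = 1"
  proof eventually_elim
    case (elim v)
    obtain Q where Q: "Q \<in> I" "v \<in> C Q"
      using cover by blast
    with elim have "(\<Sum>R\<in>I. indicat_real (C R) v) = (\<Sum>R\<in>I. if R = Q then 1 else 0)"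
      by (intro sum.cong) (auto simp: indicator_def)
    then show ?case
      using fin Q by simp
  qed
  \<comment> \<open>Uniqueness of \<open>P\<close> enters here: every other tile through
    \<open>x\<close> has \<open>x\<close> as a non-extreme point.\<close>
  have "\<exists>l. l \<noteq> 0 \<and> (\<forall>v. v - l \<in> C Q \<longleftrightarrow> v \<in> C Q)" if "Q \<in> I" "Q \<noteq> P" for Q
    unfolding C_def using that tile uniq
    by (intro tangent_cone_invariant) (auto simp: I_def polytope_imp_convex)
  then obtain l0 where l0: "\<And>Q. Q \<in> I \<Longrightarrow> Q \<noteq> P \<Longrightarrow> l0 Q \<noteq> 0"
      "\<And>Q v. Q \<in> I \<Longrightarrow> Q \<noteq> P \<Longrightarrow> v - l0 Q \<in> C Q \<longleftrightarrow> v \<in> C Q"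
    by metis
  obtain b :: "real ^ 'n" where b: "b \<noteq> 0"
    by (metis nonempty_Basis ex_in_conv nonzero_Basis)
  \<comment> \<open>The index \<open>P\<close> is reused for the constant \<open>-1\<close>, which is invariant under every translation.\<close>
  define l where "l Q = (if Q = P then b else l0 Q)" for Q
  define g where "g Q v = (if Q = P then -1 else indicat_real (C Q) v)" for Q v
  obtain u where u: "\<And>v. v \<in> C P \<Longrightarrow> norm v \<le> u \<bullet> v"
    using tangent_cone_pointed[of P x] tile P by (auto simp: C_def)
  have "AE v in lebesgue. indicat_real (C P) v = 0"
  proof (rule AE_zero_if_sum_invariant[OF fin, of l g _ u 0])
    show "l Q \<noteq> 0" if "Q \<in> I" for Q
      using that l0 b by (simp add: l_def)
    show "g Q (v - l Q) = g Q v" if "Q \<in> I" for Q v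
      using that l0 by (simp add: l_def g_def indicator_def)
    show "norm v \<le> u \<bullet> v + 0" if "indicat_real (C P) v \<noteq> 0" for v
      using that u by (simp add: indicator_def split: if_splits)
    show "AE v in lebesgue. indicat_real (C P) v + (\<Sum>Q\<in>I. g Q v) = 0"
      using sum1
    proof eventually_elim
      case (elim v)
      have "(\<Sum>Q\<in>I - {P}. g Q v) = (\<Sum>Q\<in>I - {P}. indicat_real (C Q) v)"
        by (intro sum.cong) (auto simp: g_def)
      with elim show ?case
        using fin PI by (simp add: sum.remove[of I P] g_def)
    qed
  qed
  then have "negligible (C P)"
    by (simp add: AE_lebesgue_iff_negligible indicator_def)
  \<comment> \<open>Step length 1 places the translated tile in its cone, so a null cone would
    contradict the nonempty interior of \<open>P\<close>.\<close>
  moreover have "(+) (- x) ` P \<subseteq> C P"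
    by (auto simp: C_def tangent_cone_def intro!: exI[of _ 1])
  ultimately have "negligible P"
    by (metis negligible_subset negligible_translation_rev)
  then have "negligible (interior P)"
    using interior_subset negligible_subset by blast
  then show False
    using open_not_negligible[of "interior P"] tile P by simp
qed

end
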